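(* Let $\omega$ be a weight function with associated weight matrix $\{W^x\}_{x>0}$ satisfying $$\forall x>0\ \exists y>0\ \exists A>0\ \forall k\ge1:\ \vartheta^x_k\le A(W^y_k)^{1/k}.$$ Then the following are equivalent: (1) $\omega$ is strong; (2) $\forall x>0\ \exists y>0\ \exists C>0\ \forall k\ge1:\ \sum_{\ell\ge k}\frac1{\vartheta^y_\ell}\le C\frac{k}{\vartheta^x_k}$; (3) $\exists x>0\ \exists y>0\ \exists C>0\ \forall k\ge1:\ \sum_{\ell\ge k}\frac1{\vartheta^y_\ell}\le C\frac{k}{\vartheta^x_k}$. Moreover, if $\omega$ is strong, then there exists a family $\{S^x\}_{x>0}$ of strongly log-convex weight sequences such that $\forall x>0\ \exists y>0:\ \sigma^x\lesssim\vartheta^y$ and $\forall x>0\ \exists y>0:\ \vartheta^x\lesssim\sigma^y$, and $\omega$ is good.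
   Context: A weight function is a continuous increasing $\omega:[0,\infty)\to[0,\infty)$ with $\omega(0)=0$, $\omega(t)\to\infty$, $\omega(2t)=O(\omega(t))$, $\omega(t)=O(t)$, $\log t=o(\omega(t))$, and $\varphi(t)=\omega(e^t)$ convex; normalized with $\omega|_{[0,1]}=0$, $\varphi^*(t)=\sup_{s\ge0}(st-\varphi(s))$, $W^x_k=\exp(\frac1x\varphi^*(xk))$, $\vartheta^x_k=W^x_k/W^x_{k-1}$. $\omega$ is strong if $\int_1^\infty\frac{\omega(tu)}{u^2}du\le C\omega(t)+C$ for all $t>0$ and some $C>0$; $\omega$ is good if $\forall x>0\ \exists y>0\ \exists C\ge1\ \forall1\le j\le k:\ \vartheta^x_j/j\le C\vartheta^y_k/k$. A weight sequence is given by an increasing sequence $1=\sigma_0\le\sigma_1\le\cdots$ via $S_k=\sigma_0\cdots\sigma_k=k!\,s_k$ with $S_k^{1/k}\to\infty$; it is strongly log-convex if $(s_k)$ is log-convex. For sequences, $a\lesssim b$ means $a_k\le Cb_k$ for all $k$ with some $C>0$. *)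

theory Defs
  imports "HOL-Analysis.Analysis" "HOL-Library.Landau_Symbols"
begin

text \<open>Weight functions (normalized), as functions real to real; only the restriction
  to the half-line [0,infinity) is relevant.\<close>

definition weight_function :: "(real \<Rightarrow> real) \<Rightarrow> bool" where
  "weight_function \<omega> \<longleftrightarrow>
     continuous_on {0..} \<omega> \<and>
     mono_on {0..} \<omega> \<and>
     (\<forall>t\<ge>0. \<omega> t \<ge> 0) \<and>
     \<omega> 0 = 0 \<and>
     filterlim \<omega> at_top at_top \<and>
     (\<lambda>t. \<omega> (2 * t)) \<in> O[at_top](\<omega>) \<and>
     \<omega> \<in> O[at_top](\<lambda>t. t) \<and>
     ln \<in> o[at_top](\<omega>) \<and>
     convex_on UNIV (\<lambda>t. \<omega> (exp t)) \<and>
     (\<forall>t\<in>{0..1}. \<omega> t = 0)"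

definition phi_star :: "(real \<Rightarrow> real) \<Rightarrow> real \<Rightarrow> real" where
  "phi_star \<omega> t = (SUP s\<in>{0..}. s * t - \<omega> (exp s))"

definition W :: "(real \<Rightarrow> real) \<Rightarrow> real \<Rightarrow> nat \<Rightarrow> real" where
  "W \<omega> x k = exp (phi_star \<omega> (x * real k) / x)"

text \<open>vartheta^x_k = W^x_k / W^x_{k-1}; (for k = 0 this gives 1 by truncated subtraction,
  matching the convention sigma_0 = 1; only k >= 1 is used in the paper).\<close>

definition vartheta :: "(real \<Rightarrow> real) \<Rightarrow> real \<Rightarrow> nat \<Rightarrow> real" where
  "vartheta \<omega> x k = W \<omega> x k / W \<omega> x (k - 1)"

definition strong_weight :: "(real \<Rightarrow> real) \<Rightarrow> bool" where
  "strong_weight \<omega> \<longleftrightarrow>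
     (\<exists>C>0. \<forall>t>0. (\<integral>\<^sup>+ u\<in>{1..}. ennreal (\<omega> (t * u) / u\<^sup>2) \<partial>lborel)
                    \<le> ennreal (C * \<omega> t + C))"

definition good_weight :: "(real \<Rightarrow> real) \<Rightarrow> bool" where
  "good_weight \<omega> \<longleftrightarrow>
     (\<forall>x>0. \<exists>y>0. \<exists>C\<ge>1. \<forall>j k. 1 \<le> j \<and> j \<le> k \<longrightarrow>
        vartheta \<omega> x j / real j \<le> C * vartheta \<omega> y k / real k)"

text \<open>Weight sequences given by the quotient sequence sigma; S_k = sigma_0 ... sigma_k.\<close>

definition Sprod :: "(nat \<Rightarrow> real) \<Rightarrow> nat \<Rightarrow> real" where
  "Sprod \<sigma> k = (\<Prod>i\<in>{0..k}. \<sigma> i)"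

definition weight_sequence :: "(nat \<Rightarrow> real) \<Rightarrow> bool" where
  "weight_sequence \<sigma> \<longleftrightarrow>
     \<sigma> 0 = 1 \<and> incseq \<sigma> \<and>
     filterlim (\<lambda>k. Sprod \<sigma> k powr (1 / real k)) at_top sequentially"

definition strongly_log_convex :: "(nat \<Rightarrow> real) \<Rightarrow> bool" where
  "strongly_log_convex \<sigma> \<longleftrightarrow>
     (\<forall>k\<ge>1. (Sprod \<sigma> k / fact k)\<^sup>2
              \<le> (Sprod \<sigma> (k - 1) / fact (k - 1)) * (Sprod \<sigma> (k + 1) / fact (k + 1)))"

definition lesssim :: "(nat \<Rightarrow> real) \<Rightarrow> (nat \<Rightarrow> real) \<Rightarrow> bool" where
  "lesssim a b \<longleftrightarrow> (\<exists>C>0. \<forall>k. a k \<le> C * b k)"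

end

theory Submission
  imports Defs
begin

text \<open>
  Put $G(t) = \exp(\varphi^*(t)/t)$, an increasing function with
  $(W^x_k)^{1/k} = G(xk) \le \vartheta^x_k$; by hypothesis $\vartheta^x_k \le A\,G(yk)$ conversely,
  so everything can be read off $G$. The pivot is the condition $G(Lt) \ge K\,G(t)$ for large $t$
  with some $K > L > 1$. By Young conjugation it is equivalent to
  $\omega(Kv) \le L\,\omega(v) + C$, possibly with other constants $K > L > 1$, and this in turn is
  strength of $\omega$. It makes $G$ grow at least like a power $t^\alpha$ with $\alpha > 1$, which
  gives the tail estimate and goodness. Then $\sigma^x_k = k \max_{1 \le j \le k} \vartheta^x_j/j$ is
  the required family.

  Both passages from a sum or integral condition to a growth condition use the same trick: if the
  tails of a nonnegative sequence satisfy $\sum_{i \ge j} f_i \le D f_j$ for all $j$, then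
  $f_n \le D f_j$ for $j < n$, and summing over $j$ gives $n f_n \le D^2 f_0$; so $f_n$ is a small
  fraction of $f_0$ for large $n$. It is applied to the dyadic samples of $\omega(t)/t$ and of
  $t/G(t)$.
\<close>

section \<open>Roots of the weight matrix; estimates for reals and sequences\<close>

text \<open>The function $G$ of the overview: one function of $t = xk$ serves all indices $x$ of the
  matrix.\<close>

definition W_root :: "(real \<Rightarrow> real) \<Rightarrow> real \<Rightarrow> real" where
  "W_root \<omega> t = exp (phi_star \<omega> t / t)"

lemma W_root_pos [simp]: "W_root \<omega> t > 0"
  by (simp add: W_root_def)

lemma W_powr_inverse_eq_W_root:
  assumes "k \<ge> 1"
  shows "W \<omega> x k powr (1 / real k) = W_root \<omega> (x * real k)"
  using assms by (simp add: W_def W_root_def powr_def)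

lemma vartheta_pos [simp]: "vartheta \<omega> x k > 0"
  by (simp add: vartheta_def W_def)

lemma vartheta_0 [simp]: "vartheta \<omega> x 0 = 1"
  by (simp add: vartheta_def W_def)

text \<open>Extends estimates iterated along powers of a base to arbitrary real factors.\<close>

lemma real_power_bracket:
  fixes b x :: real
  assumes "b > 1" "x \<ge> 1"
  obtains n where "b ^ n \<le> x" "x < b ^ Suc n"
proof -
  obtain m where m: "x < b ^ m" using real_arch_pow[OF assms(1)] by blast
  define n where "n = (LEAST n. x < b ^ n)"
  have n: "x < b ^ n" unfolding n_def by (rule LeastI[of _ m]) (fact m)
  with assms(2) obtain i where i: "n = Suc i" by (cases n) auto
  have "\<not> x < b ^ i" using not_less_Least[of i "\<lambda>n. x < b ^ n"] i n_def by simp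
  with n i show ?thesis by (intro that[of i]) auto
qed

text \<open>The mean value theorem produces $z$ with $m < z < m + 1 \<le> 2m$; replacing $z$ by $2m$
  costs the factor \<open>2 powr \<alpha>\<close>.\<close>

lemma powr_minus_le_telescope:
  fixes m \<alpha> :: real
  assumes "1 < \<alpha>" "1 \<le> m"
  shows "m powr (- \<alpha>) \<le> 2 powr \<alpha> / (\<alpha> - 1) * (m powr (1 - \<alpha>) - (m + 1) powr (1 - \<alpha>))"
proof -
  have "\<exists>z. m < z \<and> z < m + 1 \<and> (m + 1) powr (1 - \<alpha>) - m powr (1 - \<alpha>)
      = (m + 1 - m) * ((1 - \<alpha>) * z powr (- \<alpha>))"
    using assms by (intro MVT2) (auto intro!: derivative_eq_intros)
  then obtain z where z: "m < z" "z < m + 1"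
    "m powr (1 - \<alpha>) - (m + 1) powr (1 - \<alpha>) = (\<alpha> - 1) * z powr (- \<alpha>)"
    by (auto simp: algebra_simps)
  have "2 powr (- \<alpha>) * m powr (- \<alpha>) = (2 * m) powr (- \<alpha>)"
    using assms by (simp add: powr_mult)
  also have "\<dots> \<le> z powr (- \<alpha>)" using z assms by (intro powr_mono2') auto
  finally have "2 powr \<alpha> * (2 powr (- \<alpha>) * m powr (- \<alpha>)) \<le> 2 powr \<alpha> * z powr (- \<alpha>)"
    by (intro mult_left_mono) auto
  moreover have "2 powr \<alpha> * 2 powr (- \<alpha>) = (1 :: real)"
    by (simp add: powr_add[symmetric])
  ultimately have "m powr (- \<alpha>) \<le> 2 powr \<alpha> * z powr (- \<alpha>)"
    by (simp add: mult.assoc[symmetric])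
  then show ?thesis using assms z by simp
qed

text \<open>Telescoping gives a bound free of \<open>n\<close>, which later yields both summability
  and the bound on the infinite tail.\<close>

lemma sum_powr_minus_tail_le:
  fixes \<alpha> :: real
  assumes "1 < \<alpha>" "1 \<le> k"
  shows "(\<Sum>l<n. real (l + k) powr (- \<alpha>)) \<le> 2 powr \<alpha> / (\<alpha> - 1) * real k powr (1 - \<alpha>)"
proof -
  define D where "D = 2 powr \<alpha> / (\<alpha> - 1)"
  have D: "D \<ge> 0" using assms by (simp add: D_def)
  have "(\<Sum>l<n. real (l + k) powr (- \<alpha>))
      \<le> (\<Sum>l<n. D * (real (l + k) powr (1 - \<alpha>) - real (Suc l + k) powr (1 - \<alpha>)))"
  proof (rule sum_mono)
    fix l
    show "real (l + k) powr (- \<alpha>)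
        \<le> D * (real (l + k) powr (1 - \<alpha>) - real (Suc l + k) powr (1 - \<alpha>))"
      using powr_minus_le_telescope[of \<alpha> "real (l + k)"] assms by (simp add: D_def add_ac)
  qed
  also have "\<dots> = D * (real k powr (1 - \<alpha>) - real (n + k) powr (1 - \<alpha>))"
    using sum_lessThan_telescope'[of "\<lambda>l. real (l + k) powr (1 - \<alpha>)" n]
    by (simp add: sum_distrib_left[symmetric])
  also have "\<dots> \<le> D * real k powr (1 - \<alpha>)" using D by (intro mult_left_mono) auto
  finally show ?thesis by (simp add: D_def)
qed

text \<open>The numbers \<open>\<rho>\<close> are the factors leading from each $s_k$ to the next,
  so log-convexity of $(s_k)$ reduces to their monotonicity.\<close>

lemma strongly_log_convex_if_ratio_mono:
  fixes \<rho> :: "nat \<Rightarrow> real"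
  assumes \<sigma>: "\<And>k. \<sigma> (Suc k) = real (Suc k) * \<rho> (Suc k)"
    and \<rho>: "\<And>k. 0 \<le> \<rho> (Suc k)" "\<And>k. \<rho> (Suc k) \<le> \<rho> (Suc (Suc k))"
  shows "strongly_log_convex \<sigma>"
proof -
  define s where "s = (\<lambda>k. Sprod \<sigma> k / fact k)"
  have step: "s (Suc k) = s k * \<rho> (Suc k)" for k
    by (simp add: s_def Sprod_def \<sigma> del: of_nat_Suc)
  have "(s k)\<^sup>2 \<le> s (k - 1) * s (k + 1)" if k: "1 \<le> k" for k
  proof -
    obtain j where j: "k = Suc j" using k by (cases k) auto
    have "(s k)\<^sup>2 = (s j)\<^sup>2 * \<rho> (Suc j) * \<rho> (Suc j)" by (simp add: j step power2_eq_square)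
    also have "\<dots> \<le> (s j)\<^sup>2 * \<rho> (Suc j) * \<rho> (Suc (Suc j))"
      using \<rho> by (intro mult_left_mono) auto
    also have "\<dots> = s (k - 1) * s (k + 1)" by (simp add: j step power2_eq_square)
    finally show ?thesis .
  qed
  then show ?thesis unfolding strongly_log_convex_def s_def by blast
qed

section \<open>Young conjugation and monotonicity of the roots\<close>

locale weight_fun =
  fixes \<omega> :: "real \<Rightarrow> real"
  assumes wf: "weight_function \<omega>"
begin

lemma omega_mono: "0 \<le> s \<Longrightarrow> s \<le> t \<Longrightarrow> \<omega> s \<le> \<omega> t"
  using wf by (auto simp: weight_function_def mono_on_def)

lemma omega_nonneg: "0 \<le> t \<Longrightarrow> 0 \<le> \<omega> t"
  using wf by (auto simp: weight_function_def)

lemma young: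
  assumes "0 \<le> s"
  shows "s * t - \<omega> (exp s) \<le> phi_star \<omega> t"
proof -
  have "ln \<in> o[at_top](\<omega>)" using wf by (simp add: weight_function_def)
  \<comment> \<open>With this constant, $s(|t|+1)$ is at most \<open>\<omega> (exp s)\<close> once
    \<open>exp s \<ge> X\<close>, so the expression is nonpositive there; otherwise $s$ is at most
    $|X|$.\<close>
  then have "eventually (\<lambda>v. norm (ln v) \<le> 1 / (\<bar>t\<bar> + 1) * norm (\<omega> v)) at_top"
    by (rule landau_o.smallD) simp
  then obtain X where X: "\<And>v. v \<ge> X \<Longrightarrow> norm (ln v) \<le> 1 / (\<bar>t\<bar> + 1) * norm (\<omega> v)"
    by (auto simp: eventually_at_top_linorder)
  have bd: "s * t - \<omega> (exp s) \<le> \<bar>X\<bar> * \<bar>t\<bar>" if "s \<ge> 0" for s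
  proof -
    have st: "s * t \<le> s * \<bar>t\<bar>" using that by (intro mult_left_mono) auto
    have n: "\<omega> (exp s) \<ge> 0" by (simp add: omega_nonneg)
    show ?thesis
    proof (cases "exp s \<ge> X")
      case True
      have "s * (\<bar>t\<bar> + 1) \<le> \<omega> (exp s)"
        using X[OF True] that n by (simp add: field_simps)
      then have "s * \<bar>t\<bar> \<le> \<omega> (exp s)" using that by (simp add: algebra_simps)
      moreover have "0 \<le> \<bar>X\<bar> * \<bar>t\<bar>" by simp
      ultimately show ?thesis using st by linarith
    next
      case False
      then have "s \<le> \<bar>X\<bar>" using exp_ge_add_one_self[of s] by linarith
      then have "s * \<bar>t\<bar> \<le> \<bar>X\<bar> * \<bar>t\<bar>" by (intro mult_right_mono) auto
      then show ?thesis using st n by linarith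
    qed
  qed
  have "bdd_above ((\<lambda>s. s * t - \<omega> (exp s)) ` {0..})"
    by (rule bdd_aboveI2[where M="\<bar>X\<bar> * \<bar>t\<bar>"]) (use bd in auto)
  then show ?thesis unfolding phi_star_def using assms by (intro cSUP_upper) auto
qed

lemma phi_star_le:
  assumes "\<And>s. 0 \<le> s \<Longrightarrow> s * t - \<omega> (exp s) \<le> b"
  shows "phi_star \<omega> t \<le> b"
  unfolding phi_star_def using assms by (intro cSUP_least) auto

lemma phi_star_nonneg: "phi_star \<omega> t \<ge> 0"
  using young[of 0 t] wf by (auto simp: weight_function_def)

text \<open>Shrinking the weight of the nonnegative \<open>\<omega>\<close> from 1 to $t/u$ only
  enlarges the expression under the supremum. This is what makes \<open>W_root\<close>
  increasing.\<close>

lemma phi_star_scale: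
  assumes "0 \<le> t" "t \<le> u" "0 < u"
  shows "phi_star \<omega> t \<le> (t / u) * phi_star \<omega> u"
proof (rule phi_star_le)
  fix s :: real assume s: "0 \<le> s"
  have "t / u * \<omega> (exp s) \<le> 1 * \<omega> (exp s)"
    using assms by (intro mult_right_mono) (auto simp: omega_nonneg)
  then have "s * t - \<omega> (exp s) \<le> (t / u) * (s * u - \<omega> (exp s))"
    using assms by (simp add: right_diff_distrib)
  also have "\<dots> \<le> (t / u) * phi_star \<omega> u"
    using assms young[OF s, of u] by (intro mult_left_mono) auto
  finally show "s * t - \<omega> (exp s) \<le> (t / u) * phi_star \<omega> u" .
qed

lemma phi_star_mono:
  assumes "0 \<le> t" "t \<le> u"
  shows "phi_star \<omega> t \<le> phi_star \<omega> u"
proof (rule phi_star_le)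
  fix s :: real assume s: "0 \<le> s"
  have "s * t \<le> s * u" using s assms by (intro mult_left_mono) auto
  then show "s * t - \<omega> (exp s) \<le> phi_star \<omega> u" using young[OF s, of u] by linarith
qed

lemma W_root_mono:
  assumes "0 < t" "t \<le> u"
  shows "W_root \<omega> t \<le> W_root \<omega> u"
  using phi_star_scale[of t u] assms by (simp add: W_root_def field_simps)

lemma W_root_ge_1: "0 < t \<Longrightarrow> W_root \<omega> t \<ge> 1"
  by (simp add: W_root_def phi_star_nonneg)

lemma W_root_at_top: "filterlim (W_root \<omega>) at_top at_top"
  unfolding filterlim_at_top_ge[where c=1]
proof (intro allI impI)
  fix Z :: real assume Z: "1 \<le> Z"
  \<comment> \<open>Testing the supremum at this single point leaves a surplus $t$ over
    \<open>ln Z * t\<close>, which absorbs \<open>\<omega> (exp s)\<close> for large $t$.\<close>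
  define s where "s = ln Z + 1"
  have s: "s \<ge> 0" using Z by (simp add: s_def)
  show "eventually (\<lambda>t. Z \<le> W_root \<omega> t) at_top"
    using eventually_ge_at_top[of "\<omega> (exp s)"] eventually_gt_at_top[of 0]
  proof eventually_elim
    case (elim t)
    have "ln Z * t \<le> s * t - \<omega> (exp s)" using elim by (simp add: s_def algebra_simps)
    also have "\<dots> \<le> phi_star \<omega> t" by (rule young[OF s])
    finally have "ln Z \<le> phi_star \<omega> t / t" using elim by (simp add: field_simps)
    then have "exp (ln Z) \<le> W_root \<omega> t" unfolding W_root_def by simp
    then show ?case using Z by simp
  qed
qed

text \<open>The logarithm of \<open>vartheta \<omega> x k\<close> is the slope of
  \<open>phi_star \<omega>\<close> over $[x(k-1), xk]$, which is at least the slope of the chord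
  from the origin to $xk$.\<close>

lemma W_root_le_vartheta:
  assumes "0 < x" "1 \<le> k"
  shows "W_root \<omega> (x * real k) \<le> vartheta \<omega> x k"
proof -
  have "phi_star \<omega> (x * real (k - 1)) \<le> (x * real (k - 1)) / (x * real k) * phi_star \<omega> (x * real k)"
    using assms by (intro phi_star_scale) (auto intro!: mult_left_mono)
  also have "(x * real (k - 1)) / (x * real k) = 1 - 1 / real k"
    using assms by (simp add: of_nat_diff field_simps)
  finally have "phi_star \<omega> (x * real k) / real k
      \<le> phi_star \<omega> (x * real k) - phi_star \<omega> (x * real (k - 1))"
    by (simp add: algebra_simps)
  then have "phi_star \<omega> (x * real k) / real k / x
      \<le> (phi_star \<omega> (x * real k) - phi_star \<omega> (x * real (k - 1))) / x"
    using assms by (intro divide_right_mono) auto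
  then show ?thesis
    by (simp add: W_root_def vartheta_def W_def exp_diff[symmetric] diff_divide_distrib mult.commute)
qed

text \<open>Biduality with the maximum attained: \<open>t\<close> is the slope of a supporting line
  at \<open>s\<close> of the convex function \<open>\<lambda>s. \<omega> (exp s)\<close>,
  nonnegative by monotonicity.\<close>

lemma biconjugate_attained:
  obtains t where "0 \<le> t" "\<omega> (exp s) \<le> s * t - phi_star \<omega> t"
proof -
  define \<phi> where "\<phi> = (\<lambda>s. \<omega> (exp s))"
  \<comment> \<open>The right derivative at \<open>s\<close>, as an infimum of difference
    quotients.\<close>
  define t where "t = Inf ((\<lambda>t. (\<phi> s - \<phi> t) / (s - t)) ` ({s<..} \<inter> UNIV))"
  have "convex_on UNIV \<phi>" using wf by (simp add: weight_function_def \<phi>_def)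
  then have tan: "\<phi> r \<ge> \<phi> s + t * (r - s)" for r
    unfolding t_def by (intro convex_le_Inf_differential) auto
  have "\<phi> (s - 1) \<le> \<phi> s" unfolding \<phi>_def by (intro omega_mono) auto
  with tan[of "s - 1"] have "0 \<le> t" by simp
  moreover have "phi_star \<omega> t \<le> s * t - \<phi> s"
  proof (rule phi_star_le)
    fix r :: real
    show "r * t - \<omega> (exp r) \<le> s * t - \<phi> s"
      using tan[of r] by (simp add: \<phi>_def algebra_simps)
  qed
  ultimately show ?thesis using that[of t] by (simp add: \<phi>_def)
qed

section \<open>Two growth conditions and their duality\<close>

text \<open>Iterated, this bounds the growth of \<open>\<omega>\<close> by a power with exponent $ln
  L / ln K < 1$.\<close>

definition sublinear_dilation :: bool where
  "sublinear_dilation \<longleftrightarrow>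
     (\<exists>K L C. 1 < L \<and> L < K \<and> 0 \<le> C \<and> (\<forall>v\<ge>0. \<omega> (K * v) \<le> L * \<omega> v + C))"

text \<open>Here \<open>L\<close> dilates the argument and \<open>K\<close> multiplies the value, so
  iteration gives growth at least with exponent $ln K / ln L > 1$.\<close>

definition superlinear_root :: bool where
  "superlinear_root \<longleftrightarrow>
     (\<exists>K L t\<^sub>0. 1 < L \<and> L < K \<and> 0 < t\<^sub>0 \<and>
        (\<forall>t\<ge>t\<^sub>0. K * W_root \<omega> t \<le> W_root \<omega> (L * t)))"

text \<open>In the logarithmic variable, dilation by \<open>K\<close> is a shift by
  \<open>ln K\<close>. Testing the conjugate at $Lt$ in the shifted point gains $L t ln K$.\<close>

lemma sublinear_dilation_imp_superlinear_root:
  assumes sublinear_dilation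
  shows superlinear_root
proof -
  obtain K L C where KL: "1 < L" "L < K" "0 \<le> C"
    and dil: "\<And>v. 0 \<le> v \<Longrightarrow> \<omega> (K * v) \<le> L * \<omega> v + C"
    using assms unfolding sublinear_dilation_def by blast
  \<comment> \<open>Division by $Lt$ leaves the error $C/(Lt)$. Lowering \<open>K\<close> to
    \<open>M\<close>, still above \<open>L\<close>, gives the margin \<open>e\<close> that absorbs
    it from \<open>t\<^sub>0\<close> on.\<close>
  define M where "M = (K + L) / 2"
  have M: "L < M" "M < K" using KL by (auto simp: M_def field_simps)
  define e where "e = ln K - ln M"
  have e: "e > 0" using M KL by (simp add: e_def)
  have main: "L * phi_star \<omega> t \<le> phi_star \<omega> (L * t) - L * t * ln K + C" if "t > 0" for t
  proof -
    have "phi_star \<omega> t \<le> (phi_star \<omega> (L * t) - L * t * ln K + C) / L"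
    proof (rule phi_star_le)
      fix s :: real assume s: "0 \<le> s"
      have "\<omega> (exp (s + ln K)) \<le> L * \<omega> (exp s) + C"
        using dil[of "exp s"] KL by (simp add: exp_add mult.commute)
      moreover have "(s + ln K) * (L * t) - \<omega> (exp (s + ln K)) \<le> phi_star \<omega> (L * t)"
        using s KL by (intro young) auto
      ultimately show "s * t - \<omega> (exp s) \<le> (phi_star \<omega> (L * t) - L * t * ln K + C) / L"
        using KL by (simp add: field_simps)
    qed
    then show ?thesis using KL by (simp add: field_simps)
  qed
  define t\<^sub>0 where "t\<^sub>0 = C / (L * e) + 1"
  have t0: "t\<^sub>0 > 0" using e KL by (simp add: t\<^sub>0_def add_nonneg_pos)
  have "M * W_root \<omega> t \<le> W_root \<omega> (L * t)" if t: "t \<ge> t\<^sub>0" for t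
  proof -
    have tpos: "t > 0" using t t0 by simp
    have "C / (L * e) \<le> t" using t by (simp add: t\<^sub>0_def)
    then have "C \<le> L * t * e" using e KL by (simp add: field_simps)
    then have "L * phi_star \<omega> t + L * t * ln M \<le> phi_star \<omega> (L * t)"
      using main[OF tpos] by (simp add: e_def algebra_simps)
    then have "(L * phi_star \<omega> t + L * t * ln M) / (L * t) \<le> phi_star \<omega> (L * t) / (L * t)"
      using KL tpos by (intro divide_right_mono) auto
    also have "(L * phi_star \<omega> t + L * t * ln M) / (L * t) = ln M + phi_star \<omega> t / t"
      using KL tpos by (simp add: field_simps)
    finally have "exp (ln M + phi_star \<omega> t / t) \<le> W_root \<omega> (L * t)"
      unfolding W_root_def by simp
    then show ?thesis using M KL by (simp add: exp_add W_root_def)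
  qed
  then show ?thesis unfolding superlinear_root_def using KL M t0 by blast
qed

text \<open>Take the slope \<open>t\<close> at which the biconjugate is attained for
  \<open>s + ln K\<close>, and compare with Young's inequality at $t/L$. The growth condition at
  $t/L$ makes the conjugate terms cancel against \<open>t * ln K\<close>.\<close>

lemma superlinear_root_imp_sublinear_dilation:
  assumes superlinear_root
  shows sublinear_dilation
proof -
  obtain K L t\<^sub>0 where KL: "1 < L" "L < K" "0 < t\<^sub>0"
    and root: "\<And>t. t\<^sub>0 \<le> t \<Longrightarrow> K * W_root \<omega> t \<le> W_root \<omega> (L * t)"
    using assms unfolding superlinear_root_def by blast
  \<comment> \<open>The first summand serves $v \<le> 1$; the other two serve slopes with $t/L$
    below \<open>t\<^sub>0\<close>, where the growth condition gives no information.\<close>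
  define C where "C = \<omega> K + L * phi_star \<omega> t\<^sub>0 + L * t\<^sub>0 * ln K"
  have nn: "0 \<le> \<omega> K" "0 \<le> L * phi_star \<omega> t\<^sub>0" "0 \<le> L * t\<^sub>0 * ln K"
    using KL by (auto simp: omega_nonneg phi_star_nonneg)
  have "\<omega> (K * v) \<le> L * \<omega> v + C" if v: "v \<ge> 0" for v
  proof (cases "v \<le> 1")
    case True
    then have "\<omega> (K * v) \<le> \<omega> K" using KL v by (intro omega_mono) (auto intro: mult_left_le)
    moreover have "0 \<le> L * \<omega> v" using KL v by (simp add: omega_nonneg)
    ultimately show ?thesis using nn by (simp add: C_def)
  next
    case False
    define s where "s = ln v"
    have s: "s \<ge> 0" "exp s = v" using False by (auto simp: s_def)
    obtain t where t: "0 \<le> t" "\<omega> (exp (s + ln K)) \<le> (s + ln K) * t - phi_star \<omega> t"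
      by (rule biconjugate_attained)
    have ev: "exp (s + ln K) = K * v" using s KL by (simp add: exp_add mult.commute)
    have y: "s * (t / L) - \<omega> v \<le> phi_star \<omega> (t / L)" using young[OF s(1), of "t / L"] s by simp
    then have y': "s * t - L * \<omega> v \<le> L * phi_star \<omega> (t / L)" using KL by (simp add: field_simps)
    show ?thesis
    proof (cases "t / L \<ge> t\<^sub>0")
      case True
      then have "t / L > 0" using KL by linarith
      then have tp: "t > 0" using KL by (simp add: zero_less_divide_iff)
      have "K * W_root \<omega> (t / L) \<le> W_root \<omega> t" using root[OF True] KL by simp
      then have "exp (ln K + phi_star \<omega> (t / L) / (t / L)) \<le> exp (phi_star \<omega> t / t)"
        using KL by (simp add: W_root_def exp_add)
      then have "ln K + phi_star \<omega> (t / L) / (t / L) \<le> phi_star \<omega> t / t" by simp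
      then have "t * (ln K + phi_star \<omega> (t / L) / (t / L)) \<le> t * (phi_star \<omega> t / t)"
        using tp by (intro mult_left_mono) auto
      then have "t * ln K + L * phi_star \<omega> (t / L) \<le> phi_star \<omega> t"
        using tp KL by (simp add: distrib_left mult.commute)
      then show ?thesis using t(2) y' ev nn by (simp add: C_def algebra_simps)
    next
      case False
      then have tl: "t \<le> L * t\<^sub>0" using KL by (simp add: field_simps)
      have "phi_star \<omega> (t / L) \<le> phi_star \<omega> t\<^sub>0"
        using False t KL by (intro phi_star_mono) auto
      then have "L * phi_star \<omega> (t / L) \<le> L * phi_star \<omega> t\<^sub>0" using KL by simp
      moreover have "t * ln K \<le> L * t\<^sub>0 * ln K" using tl KL by (intro mult_right_mono) auto
      ultimately show ?thesis
        using t(2) y' ev nn phi_star_nonneg[of t] by (simp add: C_def algebra_simps)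
    qed
  qed
  moreover have "0 \<le> C" using nn by (simp add: C_def)
  ultimately show ?thesis unfolding sublinear_dilation_def using KL by blast
qed

section \<open>Strength as a growth condition on the weight function\<close>

text \<open>The integral dominates that of a step function on dyadic intervals.\<close>

lemma strong_dyadic_sum_le:
  assumes C: "\<And>t. t > 0 \<Longrightarrow> (\<integral>\<^sup>+ u\<in>{1..}. ennreal (\<omega> (t * u) / u\<^sup>2) \<partial>lborel) \<le> ennreal (C * \<omega> t + C)"
    and "C > 0" "t > 0"
  shows "(\<Sum>i<n. \<omega> (2 ^ i * t) / 2 ^ i) \<le> 4 * C * (\<omega> t + 1)"
proof -
  \<comment> \<open>Numerator at the left end and denominator at the right end of $[2^i, 2^{i+1})$.
    Times the length $2^i$, this is a quarter of the \<open>i\<close>-th summand.\<close>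
  define c where "c = (\<lambda>i. \<omega> (2 ^ i * t) / (2 ^ Suc i)\<^sup>2)"
  have c0: "c i \<ge> 0" for i using assms by (simp add: c_def omega_nonneg)
  have pw: "(\<Sum>i<n. ennreal (c i) * indicator {2 ^ i..<2 ^ Suc i} u)
      \<le> ennreal (\<omega> (t * u) / u\<^sup>2) * indicator {1..<2 ^ n} u" for u :: real
  proof (induction n)
    case (Suc n)
    have "ennreal (c n) * indicator {2 ^ n..<2 ^ Suc n} u
      \<le> ennreal (\<omega> (t * u) / u\<^sup>2) * indicator {2 ^ n..<2 ^ Suc n} u"
    proof (cases "u \<in> {2 ^ n..<2 ^ Suc n}")
      case True
      have up: "u > 0" using True by (auto intro: less_le_trans[of 0 "2 ^ n"])
      have "c n \<le> \<omega> (t * u) / u\<^sup>2"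
        unfolding c_def using True up assms
        by (intro frac_le omega_mono omega_nonneg power_mono) (auto simp: mult.commute intro!: mult_left_mono)
      then show ?thesis using True by (simp add: ennreal_leI)
    qed auto
    with Suc have "(\<Sum>i<Suc n. ennreal (c i) * indicator {2 ^ i..<2 ^ Suc i} u)
      \<le> ennreal (\<omega> (t * u) / u\<^sup>2) * indicator {1..<2 ^ n} u
        + ennreal (\<omega> (t * u) / u\<^sup>2) * indicator {2 ^ n..<2 ^ Suc n} u"
      by (simp add: add_mono)
    also have "\<dots> = ennreal (\<omega> (t * u) / u\<^sup>2) * indicator {1..<2 ^ Suc n} u"
      using one_le_power[of "2::real" n] by (auto simp: indicator_def simp del: one_le_power)
    finally show ?case .
  qed auto
  have "ennreal (\<Sum>i<n. c i * 2 ^ i) = (\<Sum>i<n. ennreal (c i) * emeasure lborel {2 ^ i..<2 ^ Suc i :: real})"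
    using c0 by (subst sum_ennreal[symmetric]) (auto intro!: sum.cong simp: ennreal_mult)
  also have "\<dots> = (\<integral>\<^sup>+ u. (\<Sum>i<n. ennreal (c i) * indicator {2 ^ i..<2 ^ Suc i} (u :: real)) \<partial>lborel)"
    by (subst nn_integral_sum) (auto simp: nn_integral_cmult_indicator)
  also have "\<dots> \<le> (\<integral>\<^sup>+ u\<in>{1..}. ennreal (\<omega> (t * u) / u\<^sup>2) \<partial>lborel)"
    by (intro nn_integral_mono order.trans[OF pw] mult_left_mono) (auto simp: indicator_def)
  also have "\<dots> \<le> ennreal (C * \<omega> t + C)" using C assms by blast
  finally have "(\<Sum>i<n. c i * 2 ^ i) \<le> C * \<omega> t + C"
    using assms by (subst (asm) ennreal_le_iff) (auto simp: omega_nonneg)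
  moreover have "c i * 2 ^ i = (1/4) * (\<omega> (2 ^ i * t) / 2 ^ i)" for i
    by (simp add: c_def power2_eq_square field_simps)
  ultimately have "(1/4) * (\<Sum>i<n. \<omega> (2 ^ i * t) / 2 ^ i) \<le> C * \<omega> t + C"
    by (simp add: sum_distrib_left)
  then show ?thesis by (simp add: algebra_simps)
qed

text \<open>The averaging trick of the overview with $f_i$ =
  \<open>\<omega> (2 ^ i * v) / 2 ^ i\<close>; the extra 1 in the tail bound ends up in the additive
  constant.\<close>

lemma strong_imp_sublinear_dilation:
  assumes "strong_weight \<omega>"
  shows sublinear_dilation
proof -
  obtain C where C: "C > 0" "\<And>t. t > 0 \<Longrightarrow>
      (\<integral>\<^sup>+ u\<in>{1..}. ennreal (\<omega> (t * u) / u\<^sup>2) \<partial>lborel) \<le> ennreal (C * \<omega> t + C)"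
    using assms unfolding strong_weight_def by blast
  define D where "D = 4 * C"
  have D: "D > 0" using C by (simp add: D_def)
  have tail: "(\<Sum>i<n. \<omega> (2 ^ i * t) / 2 ^ i) \<le> D * (\<omega> t + 1)" if "t > 0" for t n
    using strong_dyadic_sum_le[OF C(2) C(1) that] by (simp add: D_def)
  \<comment> \<open>$n > 4D^2$ makes $D^2/n$ less than 1/4, which gives the factor $2^n/4$ against
    the dilation $2^n$; $n \<ge> 3$ makes that factor exceed 1.\<close>
  obtain n :: nat where n: "4 * D\<^sup>2 + 3 < n" using reals_Archimedean2 by blast
  then have "real 3 < real n" using zero_le_power2[of D] by linarith
  then have n3: "n \<ge> 3" by linarith
  have "\<omega> (2 ^ n * v) \<le> (2 ^ n / 4) * \<omega> v + 2 ^ n * (1 + 2 * D)" if "v \<ge> 0" for v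
  proof (cases "v = 0")
    case True
    then show ?thesis using wf D by (simp add: weight_function_def)
  next
    case False
    then have v: "v > 0" using that by simp
    define b where "b = (\<lambda>i. \<omega> (2 ^ i * v) / 2 ^ i)"
    \<comment> \<open>The tail bound started at $2^i v$, keeping the summand with index $n -
      i$.\<close>
    have step: "b n \<le> D * (b i + 1 / 2 ^ i)" if "i < n" for i
    proof -
      have "\<omega> (2 ^ (n - i) * (2 ^ i * v)) / 2 ^ (n - i)
          \<le> (\<Sum>j<Suc (n - i). \<omega> (2 ^ j * (2 ^ i * v)) / 2 ^ j)"
        by (rule member_le_sum) (use v in \<open>auto intro!: omega_nonneg divide_nonneg_pos\<close>)
      also have "\<dots> \<le> D * (\<omega> (2 ^ i * v) + 1)" using v by (intro tail) auto
      finally have "\<omega> (2 ^ (n - i) * (2 ^ i * v)) / 2 ^ (n - i) / 2 ^ i \<le> D * (\<omega> (2 ^ i * v) + 1) / 2 ^ i"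
        by (intro divide_right_mono) auto
      moreover have "2 ^ (n - i) * (2 ^ i * v) = 2 ^ n * v" "2 ^ (n - i) * 2 ^ i = (2 ^ n :: real)"
        using that by (auto simp: power_add[symmetric] mult.assoc[symmetric])
      ultimately have "\<omega> (2 ^ n * v) / 2 ^ n \<le> D * (\<omega> (2 ^ i * v) + 1) / 2 ^ i"
        by (simp only: divide_divide_eq_left)
      then show ?thesis
        by (simp add: b_def add_divide_distrib[symmetric])
    qed
    have "real n * b n = (\<Sum>i<n. b n)" by simp
    also have "\<dots> \<le> (\<Sum>i<n. D * (b i + 1 / 2 ^ i))" by (intro sum_mono step) auto
    also have "\<dots> = D * (\<Sum>i<n. b i) + D * (\<Sum>i<n. (1/2) ^ i)"
      by (simp add: sum_distrib_left sum.distrib algebra_simps power_divide)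
    also have "\<dots> \<le> D * (D * (\<omega> v + 1)) + D * 2"
      using tail[OF v, of n] D by (intro add_mono mult_left_mono) (auto simp: b_def geometric_sum)
    finally have *: "real n * b n \<le> D\<^sup>2 * \<omega> v + D\<^sup>2 + 2 * D" by (simp add: power2_eq_square algebra_simps)
    have "D\<^sup>2 * \<omega> v \<le> (real n / 4) * \<omega> v" using n v by (intro mult_right_mono omega_nonneg) auto
    moreover have "D\<^sup>2 \<le> real n" using n zero_le_power2[of D] by linarith
    moreover have "2 * D \<le> real n * (2 * D)" using D n3 by simp
    ultimately have "real n * b n \<le> real n * (\<omega> v / 4 + 1 + 2 * D)"
      using * by (simp add: algebra_simps)
    then have "b n \<le> \<omega> v / 4 + 1 + 2 * D" using n3 by simp
    then show ?thesis by (simp add: b_def field_simps)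
  qed
  moreover have "(1::real) < 2 ^ n / 4"
    using power_increasing[OF n3, of "2::real"] by simp
  moreover have "2 ^ n / 4 < (2 ^ n :: real)" by simp
  ultimately show ?thesis unfolding sublinear_dilation_def using D
    by (intro exI[of _ "2 ^ n"] exI[of _ "2 ^ n / 4"] exI[of _ "2 ^ n * (1 + 2 * D)"]) auto
qed

text \<open>Iteration bounds \<open>\<omega> (t * u)\<close> by a power of \<open>u\<close> with
  exponent \<open>\<alpha> < 1\<close>, so the integrand decays like
  \<open>u powr (\<alpha> - 2)\<close>, which is integrable at infinity.\<close>

lemma sublinear_dilation_imp_strong:
  assumes sublinear_dilation
  shows "strong_weight \<omega>"
proof -
  obtain K L C where KL: "1 < L" "L < K" "0 \<le> C"
    and dil: "\<And>v. 0 \<le> v \<Longrightarrow> \<omega> (K * v) \<le> L * \<omega> v + C"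
    using assms unfolding sublinear_dilation_def by blast
  define \<alpha> where "\<alpha> = ln L / ln K"
  have \<alpha>: "0 < \<alpha>" "\<alpha> < 1" using KL by (auto simp: \<alpha>_def)
  have K\<alpha>: "K powr \<alpha> = L" using KL by (simp add: \<alpha>_def powr_def)
  \<comment> \<open>Chosen with $Lc = c + C$, so that \<open>\<omega> + c\<close> satisfies a purely
    geometric recursion.\<close>
  define c where "c = C / (L - 1)"
  have c: "c \<ge> 0" "L * c = c + C" using KL by (auto simp: c_def field_simps)
  have iter: "\<omega> (K ^ i * v) + c \<le> L ^ i * (\<omega> v + c)" if "v \<ge> 0" for i v
  proof (induction i)
    case (Suc i)
    have "\<omega> (K ^ Suc i * v) + c \<le> L * (\<omega> (K ^ i * v) + c)"
      using dil[of "K ^ i * v"] that KL c by (simp add: algebra_simps)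
    also have "\<dots> \<le> L * (L ^ i * (\<omega> v + c))" using Suc KL by (intro mult_left_mono) auto
    finally show ?case by (simp add: mult.assoc)
  qed auto
  have pw: "\<omega> (t * u) \<le> L * (\<omega> t + c) * u powr \<alpha>" if tu: "t > 0" "u \<ge> 1" for t u
  proof -
    obtain i where i: "K ^ i \<le> u" "u < K ^ Suc i"
      by (rule real_power_bracket[of K u]) (use KL tu in auto)
    have "L ^ i = (K ^ i) powr \<alpha>"
      using KL by (simp add: K\<alpha>[symmetric] powr_realpow[symmetric] powr_powr mult.commute)
    also have "\<dots> \<le> u powr \<alpha>" using i KL \<alpha> by (intro powr_mono2) auto
    finally have Li: "L ^ i \<le> u powr \<alpha>" .
    \<comment> \<open>Rounding \<open>u\<close> up to the next power of \<open>K\<close> costs one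
      factor \<open>L\<close>.\<close>
    have "\<omega> (t * u) \<le> \<omega> (K ^ Suc i * t)"
      using i tu by (intro omega_mono) (auto simp: mult.commute)
    also have "\<dots> \<le> L ^ Suc i * (\<omega> t + c)" using iter[of t "Suc i"] tu c by linarith
    also have "\<dots> = L ^ i * (L * (\<omega> t + c))" by simp
    also have "\<dots> \<le> u powr \<alpha> * (L * (\<omega> t + c))"
      using Li KL tu c by (intro mult_right_mono) (auto simp: omega_nonneg)
    finally show ?thesis by (simp add: mult_ac)
  qed
  define B where "B = L * (1 + c) / (1 - \<alpha>)"
  have B: "B > 0" using KL c \<alpha> by (simp add: B_def)
  have "(\<integral>\<^sup>+ u\<in>{1..}. ennreal (\<omega> (t * u) / u\<^sup>2) \<partial>lborel) \<le> ennreal (B * \<omega> t + B)"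
    if t: "t > 0" for t
  proof -
    define a where "a = L * (\<omega> t + c)"
    have a: "a \<ge> 0" using KL c t by (auto simp: a_def omega_nonneg)
    have "(\<integral>\<^sup>+ u\<in>{1..}. ennreal (\<omega> (t * u) / u\<^sup>2) \<partial>lborel)
        \<le> (\<integral>\<^sup>+ u\<in>{1..}. ennreal (a * u powr (\<alpha> - 2)) \<partial>lborel)"
    proof (rule nn_integral_mono)
      fix u :: real
      have "\<omega> (t * u) / u\<^sup>2 \<le> a * u powr (\<alpha> - 2)" if "u \<ge> 1"
        using pw[OF t that] that by (simp add: a_def powr_diff field_simps)
      then show "ennreal (\<omega> (t * u) / u\<^sup>2) * indicator {1..} u
          \<le> ennreal (a * u powr (\<alpha> - 2)) * indicator {1..} u"
        by (auto simp: indicator_def ennreal_leI)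
    qed
    also have "\<dots> = ennreal (0 - (- (a / (1 - \<alpha>)) * 1 powr (\<alpha> - 1)))"
    proof (rule nn_integral_FTC_atLeast[where F="\<lambda>u. - (a / (1 - \<alpha>)) * u powr (\<alpha> - 1)"])
      show "((\<lambda>u. - (a / (1 - \<alpha>)) * u powr (\<alpha> - 1)) has_real_derivative a * u powr (\<alpha> - 2)) (at u)"
        if "1 \<le> u" for u
        using that \<alpha> by (auto intro!: derivative_eq_intros simp: divide_simps) (auto simp: algebra_simps)
      show "((\<lambda>u. - (a / (1 - \<alpha>)) * u powr (\<alpha> - 1)) \<longlongrightarrow> 0) at_top"
        using \<alpha> by (intro tendsto_mult_right_zero tendsto_neg_powr filterlim_ident) auto
    qed (use a in auto)
    also have "\<dots> \<le> ennreal (B * \<omega> t + B)"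
    proof (rule ennreal_leI)
      have "\<omega> t + c \<le> (1 + c) * (\<omega> t + 1)" using c t omega_nonneg[of t] by (simp add: algebra_simps)
      then have "L * (\<omega> t + c) / (1 - \<alpha>) \<le> L * ((1 + c) * (\<omega> t + 1)) / (1 - \<alpha>)"
        using KL \<alpha> by (intro divide_right_mono mult_left_mono) auto
      also have "\<dots> = B * \<omega> t + B" by (simp add: B_def algebra_simps add_divide_distrib)
      finally show "0 - (- (a / (1 - \<alpha>)) * 1 powr (\<alpha> - 1)) \<le> B * \<omega> t + B"
        by (simp add: a_def)
    qed
    finally show ?thesis .
  qed
  then show ?thesis unfolding strong_weight_def using B by blast
qed

lemma strong_iff_superlinear_root: "strong_weight \<omega> \<longleftrightarrow> superlinear_root"
  using strong_imp_sublinear_dilation sublinear_dilation_imp_strong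
    sublinear_dilation_imp_superlinear_root superlinear_root_imp_sublinear_dilation by blast

section \<open>Consequences of superlinear growth of the roots\<close>

text \<open>The exponent $ln K / ln L$ serves every \<open>x\<close>; the constant \<open>c\<close>
  depends on \<open>x\<close>, because arguments below \<open>t\<^sub>0\<close> are
  included.\<close>

lemma superlinear_root_power_growth:
  assumes superlinear_root
  obtains \<alpha> where "1 < \<alpha>" "\<forall>x>0.
    \<exists>c>0. \<forall>t u. x \<le> t \<and> t \<le> u \<longrightarrow> c * (u / t) powr \<alpha> * W_root \<omega> t \<le> W_root \<omega> u"
proof -
  obtain K L t\<^sub>0 where KL: "1 < L" "L < K" "0 < t\<^sub>0"
    and root: "\<And>t. t\<^sub>0 \<le> t \<Longrightarrow> K * W_root \<omega> t \<le> W_root \<omega> (L * t)"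
    using assms unfolding superlinear_root_def by blast
  define \<alpha> where "\<alpha> = ln K / ln L"
  have \<alpha>: "1 < \<alpha>" using KL by (simp add: \<alpha>_def)
  have L\<alpha>: "L powr \<alpha> = K" using KL by (simp add: \<alpha>_def powr_def)
  have iter: "K ^ i * W_root \<omega> t \<le> W_root \<omega> (L ^ i * t)" if "t \<ge> t\<^sub>0" for i t
  proof (induction i)
    case (Suc i)
    have "1 * t\<^sub>0 \<le> L ^ i * t" using that KL by (intro mult_mono) auto
    then have "K * W_root \<omega> (L ^ i * t) \<le> W_root \<omega> (L * (L ^ i * t))" by (intro root) simp
    moreover have "K * (K ^ i * W_root \<omega> t) \<le> K * W_root \<omega> (L ^ i * t)"
      using Suc KL by (intro mult_left_mono) auto
    ultimately show ?case by (simp add: mult.assoc)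
  qed auto
  have base: "(u / t) powr \<alpha> * W_root \<omega> t \<le> K * W_root \<omega> u" if tu: "t\<^sub>0 \<le> t" "t \<le> u" for t u
  proof -
    have t: "t > 0" using tu KL by simp
    obtain i where i: "L ^ i \<le> u / t" "u / t < L ^ Suc i"
      by (rule real_power_bracket[of L "u / t"]) (use KL tu t in auto)
    have "(u / t) powr \<alpha> \<le> (L ^ Suc i) powr \<alpha>" using i \<alpha> t tu by (intro powr_mono2) auto
    also have "\<dots> = K ^ Suc i"
      using KL by (simp only: L\<alpha>[symmetric] powr_realpow[symmetric] powr_gt_zero) (simp add: powr_powr mult.commute)
    finally have "(u / t) powr \<alpha> * W_root \<omega> t \<le> K ^ Suc i * W_root \<omega> t"
      by (intro mult_right_mono) (auto simp: less_imp_le)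
    also have "\<dots> = K * (K ^ i * W_root \<omega> t)" by simp
    also have "\<dots> \<le> K * W_root \<omega> (L ^ i * t)" using iter[OF tu(1)] KL by (intro mult_left_mono) auto
    also have "\<dots> \<le> K * W_root \<omega> u"
      using i t KL by (intro mult_left_mono W_root_mono) (auto simp: field_simps)
    finally show ?thesis .
  qed
  have "\<exists>c>0. \<forall>t u. x \<le> t \<and> t \<le> u \<longrightarrow> c * (u / t) powr \<alpha> * W_root \<omega> t \<le> W_root \<omega> u"
    if x: "0 < x" for x
  proof (intro exI[of _ "(x / (x + t\<^sub>0)) powr \<alpha> / K"] conjI allI impI)
    \<comment> \<open>Since $q$ times \<open>t\<^sub>0\<close> is at most \<open>t\<close>, the
      factor \<open>q powr \<alpha>\<close> pays for replacing \<open>t\<close> by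
      \<open>t\<^sub>0\<close>; the division by \<open>K\<close> is the loss in
      \<open>base\<close>.\<close>
    define q where "q = x / (x + t\<^sub>0)"
    have q: "0 < q" "q \<le> 1" using x KL by (auto simp: q_def)
    show "0 < (x / (x + t\<^sub>0)) powr \<alpha> / K" using KL x by simp
    fix t u assume tu: "x \<le> t \<and> t \<le> u"
    have q\<alpha>: "q powr \<alpha> \<le> 1" using q \<alpha> by (intro powr_le1) auto
    have qt: "q * t\<^sub>0 \<le> t"
    proof -
      have "q * t\<^sub>0 \<le> x" using x KL by (simp add: q_def field_simps)
      then show ?thesis using tu by simp
    qed
    have "q powr \<alpha> * (u / t) powr \<alpha> * W_root \<omega> t \<le> K * W_root \<omega> u"
    proof (cases "t\<^sub>0 \<le> t")
      case True
      have "q powr \<alpha> * ((u / t) powr \<alpha> * W_root \<omega> t) \<le> 1 * ((u / t) powr \<alpha> * W_root \<omega> t)"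
        using q\<alpha> by (intro mult_right_mono) (auto simp: less_imp_le)
      then show ?thesis using base[OF True, of u] tu by (simp add: mult.assoc)
    next
      case t: False
      have e: "q powr \<alpha> * (u / t) powr \<alpha> = (q * (u / t)) powr \<alpha>"
        using x tu q by (intro powr_mult[symmetric])
      \<comment> \<open>If \<open>u\<close> reaches \<open>t\<^sub>0\<close>, start the estimate at
        \<open>t\<^sub>0\<close>; otherwise the power is at most 1 and monotonicity
        suffices.\<close>
      show ?thesis
      proof (cases "t\<^sub>0 \<le> u")
        case True
        have "q * (u / t) \<le> u / t\<^sub>0"
        proof -
          have "q * t\<^sub>0 * u \<le> t * u" using qt tu x by (intro mult_right_mono) auto
          then show ?thesis using x tu KL by (simp add: field_simps)
        qed
        then have "(q * (u / t)) powr \<alpha> \<le> (u / t\<^sub>0) powr \<alpha>"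
          using q x tu \<alpha> by (intro powr_mono2) auto
        moreover have "W_root \<omega> t \<le> W_root \<omega> t\<^sub>0" using t x tu by (intro W_root_mono) auto
        ultimately have "(q * (u / t)) powr \<alpha> * W_root \<omega> t \<le> (u / t\<^sub>0) powr \<alpha> * W_root \<omega> t\<^sub>0"
          by (intro mult_mono) (auto simp: less_imp_le)
        also have "\<dots> \<le> K * W_root \<omega> u" using True by (intro base) auto
        finally show ?thesis by (simp only: e)
      next
        case False
        have "q * u \<le> q * t\<^sub>0" using False q by simp
        then have "q * (u / t) \<le> 1" using qt x tu by (simp add: field_simps)
        then have "(q * (u / t)) powr \<alpha> \<le> K"
          using q x tu \<alpha> KL by (intro order.trans[OF powr_le1]) auto
        moreover have "W_root \<omega> t \<le> W_root \<omega> u" using x tu by (intro W_root_mono) auto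
        ultimately show ?thesis unfolding e using KL by (intro mult_mono) (auto simp: less_imp_le)
      qed
    qed
    then show "(x / (x + t\<^sub>0)) powr \<alpha> / K * (u / t) powr \<alpha> * W_root \<omega> t \<le> W_root \<omega> u"
      using KL by (simp add: q_def field_simps)
  qed
  with \<alpha> that show ?thesis by blast
qed

text \<open>With \<open>y\<close> from the hypothesis for \<open>x\<close>, the quotient at $l$ for
  \<open>y\<close> is at least $G(yl)$, hence at least $c (l/k)^a G(yk)$ with $a$ =
  \<open>\<alpha>\<close>, while the quotient at $k$ for \<open>x\<close> is at most $A G(yk)$.
  Summing $(l/k)^{-a}$ over $l \<ge> k$ gives a multiple of $k$.\<close>

lemma vartheta_tail_sum_le:
  assumes hyp: "\<forall>x>0. \<exists>y>0. \<exists>A>0. \<forall>k\<ge>1. vartheta \<omega> x k \<le> A * W \<omega> y k powr (1 / real k)"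
    and root: superlinear_root
    and x: "x > 0"
  shows "\<exists>y>0. \<exists>C>0. \<forall>k\<ge>1. summable (\<lambda>l. 1 / vartheta \<omega> y (l + k)) \<and>
           (\<Sum>l. 1 / vartheta \<omega> y (l + k)) \<le> C * real k / vartheta \<omega> x k"
proof -
  obtain \<alpha> where \<alpha>: "1 < \<alpha>" "\<forall>x>0.
    \<exists>c>0. \<forall>t u. x \<le> t \<and> t \<le> u \<longrightarrow> c * (u / t) powr \<alpha> * W_root \<omega> t \<le> W_root \<omega> u"
    by (rule superlinear_root_power_growth[OF root])
  obtain y A where y: "y > 0" "A > 0"
    and yA: "\<And>k. k \<ge> 1 \<Longrightarrow> vartheta \<omega> x k \<le> A * W_root \<omega> (y * real k)"
    using hyp x by (metis W_powr_inverse_eq_W_root)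
  obtain c where c: "c > 0"
    "\<And>t u. y \<le> t \<Longrightarrow> t \<le> u \<Longrightarrow> c * (u / t) powr \<alpha> * W_root \<omega> t \<le> W_root \<omega> u"
    using \<alpha>(2) y(1) by blast
  define D where "D = 2 powr \<alpha> / (\<alpha> - 1)"
  have D: "D > 0" using \<alpha> by (simp add: D_def)
  have "summable (\<lambda>l. 1 / vartheta \<omega> y (l + k)) \<and>
           (\<Sum>l. 1 / vartheta \<omega> y (l + k)) \<le> (A * D / c) * real k / vartheta \<omega> x k" if k: "k \<ge> 1" for k
  proof -
    have term_le: "1 / vartheta \<omega> y (l + k)
        \<le> real k powr \<alpha> / (c * W_root \<omega> (y * real k)) * real (l + k) powr (- \<alpha>)" for l
    proof -
      have "c * (y * real (l + k) / (y * real k)) powr \<alpha> * W_root \<omega> (y * real k) \<le> W_root \<omega> (y * real (l + k))"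
        using y k by (intro c) (auto intro!: mult_left_mono)
      also have "\<dots> \<le> vartheta \<omega> y (l + k)" using y k by (intro W_root_le_vartheta) auto
      also have "y * real (l + k) / (y * real k) = real (l + k) / real k" using y by simp
      finally have le: "c * (real (l + k) / real k) powr \<alpha> * W_root \<omega> (y * real k) \<le> vartheta \<omega> y (l + k)" .
      have "1 / vartheta \<omega> y (l + k) \<le> 1 / (c * (real (l + k) / real k) powr \<alpha> * W_root \<omega> (y * real k))"
        using c k by (intro divide_left_mono le mult_pos_pos) auto
      also have "\<dots> = real k powr \<alpha> / (c * W_root \<omega> (y * real k)) * real (l + k) powr (- \<alpha>)"
        using k by (simp add: powr_divide powr_minus field_simps)
      finally show ?thesis .
    qed
    have part: "(\<Sum>l<n. 1 / vartheta \<omega> y (l + k)) \<le> (A * D / c) * real k / vartheta \<omega> x k" for n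
    proof -
      have "(\<Sum>l<n. 1 / vartheta \<omega> y (l + k))
          \<le> (\<Sum>l<n. real k powr \<alpha> / (c * W_root \<omega> (y * real k)) * real (l + k) powr (- \<alpha>))"
        by (intro sum_mono term_le)
      also have "\<dots> = real k powr \<alpha> / (c * W_root \<omega> (y * real k)) * (\<Sum>l<n. real (l + k) powr (- \<alpha>))"
        by (simp only: sum_distrib_left)
      also have "\<dots> \<le> real k powr \<alpha> / (c * W_root \<omega> (y * real k)) * (D * real k powr (1 - \<alpha>))"
        unfolding D_def using \<alpha> k c
        by (intro mult_left_mono sum_powr_minus_tail_le) (auto simp: less_imp_le)
      also have "\<dots> = D * (real k powr \<alpha> * real k powr (1 - \<alpha>)) / c / W_root \<omega> (y * real k)"
        by simp
      also have "real k powr \<alpha> * real k powr (1 - \<alpha>) = real k"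
        using k by (simp add: powr_add[symmetric])
      also have "D * real k / c / W_root \<omega> (y * real k) = (A * D / c) * real k / (A * W_root \<omega> (y * real k))"
        using y by simp
      also have "\<dots> \<le> (A * D / c) * real k / vartheta \<omega> x k"
        using yA[OF k] y D c by (intro divide_left_mono mult_pos_pos mult_nonneg_nonneg) auto
      finally show ?thesis .
    qed
    have sm: "summable (\<lambda>l. 1 / vartheta \<omega> y (l + k))"
      by (rule summableI_nonneg_bounded[OF _ part]) (simp add: less_imp_le)
    show ?thesis using sm suminf_le_const[OF sm part] by blast
  qed
  then show ?thesis using y D c by (intro exI[of _ y] exI[of _ "A * D / c"] conjI) auto
qed

text \<open>As \<open>\<alpha> > 1\<close>, $G(t)/t$ is increasing up to a constant for $t \<ge> y$;
  the hypothesis at $j$ and \<open>W_root_le_vartheta\<close> at $k$ translate this to the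
  quotients.\<close>

lemma superlinear_root_imp_good:
  assumes hyp: "\<forall>x>0. \<exists>y>0. \<exists>A>0. \<forall>k\<ge>1. vartheta \<omega> x k \<le> A * W \<omega> y k powr (1 / real k)"
    and root: superlinear_root
  shows "good_weight \<omega>"
  unfolding good_weight_def
proof (intro allI impI)
  fix x :: real assume x: "x > 0"
  obtain \<alpha> where \<alpha>: "1 < \<alpha>" "\<forall>x>0.
    \<exists>c>0. \<forall>t u. x \<le> t \<and> t \<le> u \<longrightarrow> c * (u / t) powr \<alpha> * W_root \<omega> t \<le> W_root \<omega> u"
    by (rule superlinear_root_power_growth[OF root])
  obtain y A where y: "y > 0" "A > 0"
    and yA: "\<And>k. k \<ge> 1 \<Longrightarrow> vartheta \<omega> x k \<le> A * W_root \<omega> (y * real k)"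
    using hyp x by (metis W_powr_inverse_eq_W_root)
  obtain c where c: "c > 0"
    "\<And>t u. y \<le> t \<Longrightarrow> t \<le> u \<Longrightarrow> c * (u / t) powr \<alpha> * W_root \<omega> t \<le> W_root \<omega> u"
    using \<alpha>(2) y(1) by blast
  \<comment> \<open>The maximum with 1 meets the demand $C \<ge> 1$ in
    \<open>good_weight\<close>.\<close>
  have "vartheta \<omega> x j / real j \<le> max 1 (A / c) * vartheta \<omega> y k / real k" if jk: "1 \<le> j" "j \<le> k" for j k
  proof -
    have "c * ((y * real k / (y * real j)) powr 1 * W_root \<omega> (y * real j))
        \<le> c * ((y * real k / (y * real j)) powr \<alpha> * W_root \<omega> (y * real j))"
      using y jk c \<alpha> by (intro mult_left_mono mult_right_mono powr_mono) (auto simp: less_imp_le)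
    also have "\<dots> \<le> W_root \<omega> (y * real k)"
      using c(2)[of "y * real j" "y * real k"] y jk by (simp add: mult.assoc)
    also have "\<dots> \<le> vartheta \<omega> y k" using y jk by (intro W_root_le_vartheta) auto
    finally have "c * (real k / real j * W_root \<omega> (y * real j)) \<le> vartheta \<omega> y k"
      using y jk by simp
    then have *: "W_root \<omega> (y * real j) / real j \<le> (1 / c) * (vartheta \<omega> y k / real k)"
      using c jk by (simp add: field_simps)
    have "vartheta \<omega> x j / real j \<le> A * (W_root \<omega> (y * real j) / real j)"
      using yA[OF jk(1)] jk by (simp add: divide_right_mono)
    also have "\<dots> \<le> A * ((1 / c) * (vartheta \<omega> y k / real k))"
      using * y by (intro mult_left_mono) auto
    also have "\<dots> = (A / c) * (vartheta \<omega> y k / real k)" by simp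
    also have "\<dots> \<le> max 1 (A / c) * (vartheta \<omega> y k / real k)"
      by (intro mult_right_mono) (auto simp: less_imp_le)
    finally show ?thesis by simp
  qed
  then show "\<exists>y>0. \<exists>C\<ge>1. \<forall>j k. 1 \<le> j \<and> j \<le> k \<longrightarrow> vartheta \<omega> x j / real j \<le> C * vartheta \<omega> y k / real k"
    using y by (intro exI[of _ y] exI[of _ "max 1 (A / c)"] conjI) auto
qed

section \<open>From tail sums back to growth of the roots\<close>

text \<open>The hypothesis for \<open>y\<close> turns the tail into one of $1/G(zl)$. Dyadic blocks
  make it a tail bound for samples of $t/G(t)$, to which the averaging trick applies.\<close>

lemma tail_sum_imp_superlinear_root:
  assumes hyp: "\<forall>x>0. \<exists>y>0. \<exists>A>0. \<forall>k\<ge>1. vartheta \<omega> x k \<le> A * W \<omega> y k powr (1 / real k)"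
    and pos: "x > 0" "y > 0" "C > 0"
    and sums: "\<And>k. k \<ge> 1 \<Longrightarrow> summable (\<lambda>l. 1 / vartheta \<omega> y (l + k)) \<and>
           (\<Sum>l. 1 / vartheta \<omega> y (l + k)) \<le> C * real k / vartheta \<omega> x k"
  shows superlinear_root
proof -
  obtain z A where z: "z > 0" "A > 0"
    and zA: "\<And>k. k \<ge> 1 \<Longrightarrow> vartheta \<omega> y k \<le> A * W_root \<omega> (z * real k)"
    using hyp pos by (metis W_powr_inverse_eq_W_root)
  have part: "(\<Sum>l<N. 1 / W_root \<omega> (z * real (l + k))) \<le> A * C * real k / W_root \<omega> (x * real k)"
    if k: "k \<ge> 1" for k N
  proof -
    have "(\<Sum>l<N. 1 / W_root \<omega> (z * real (l + k))) \<le> (\<Sum>l<N. A * (1 / vartheta \<omega> y (l + k)))"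
    proof (rule sum_mono)
      fix l
      have "vartheta \<omega> y (l + k) \<le> A * W_root \<omega> (z * real (l + k))" using k by (intro zA) auto
      then show "1 / W_root \<omega> (z * real (l + k)) \<le> A * (1 / vartheta \<omega> y (l + k))"
        by (simp add: divide_simps mult.commute)
    qed
    also have "\<dots> = A * (\<Sum>l<N. 1 / vartheta \<omega> y (l + k))" by (simp only: sum_distrib_left)
    also have "\<dots> \<le> A * (\<Sum>l. 1 / vartheta \<omega> y (l + k))"
      using sums[OF k] z by (intro mult_left_mono sum_le_suminf) (auto simp: less_imp_le)
    also have "\<dots> \<le> A * (C * real k / vartheta \<omega> x k)"
      using sums[OF k] z by (intro mult_left_mono) auto
    also have "\<dots> \<le> A * (C * real k / W_root \<omega> (x * real k))"
      using z pos k by (intro mult_left_mono divide_left_mono W_root_le_vartheta mult_pos_pos) auto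
    finally show ?thesis by simp
  qed
  \<comment> \<open>Compares the scales \<open>z\<close> and \<open>x\<close>: for $l < 2^{N+1} k$,
    $zl$ is at most $2^{N+m+1} xk$. This is the source of the index shift $m+1$.\<close>
  obtain m where m: "z / x < 2 ^ m" using real_arch_pow[of 2 "z / x"] by auto
  then have zm: "z \<le> 2 ^ m * x" using pos by (simp add: field_simps)
  have block: "(\<Sum>i<N. 2 ^ i * real k / W_root \<omega> (2 ^ (i + m + 1) * (x * real k)))
      \<le> (\<Sum>l\<in>{k..<2 ^ N * k}. 1 / W_root \<omega> (z * real l))" if k: "k \<ge> 1" for k N
  proof (induction N)
    case (Suc N)
    have "2 ^ N * real k / W_root \<omega> (2 ^ (N + m + 1) * (x * real k))
        = (\<Sum>l\<in>{2 ^ N * k..<2 ^ Suc N * k}. 1 / W_root \<omega> (2 ^ (N + m + 1) * (x * real k)))"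
      by simp
    also have "\<dots> \<le> (\<Sum>l\<in>{2 ^ N * k..<2 ^ Suc N * k}. 1 / W_root \<omega> (z * real l))"
    proof (rule sum_mono)
      fix l assume l: "l \<in> {2 ^ N * k..<2 ^ Suc N * k}"
      have "real l \<le> real (2 ^ Suc N * k)" using l by (intro of_nat_mono) auto
      then have "z * real l \<le> (2 ^ m * x) * real (2 ^ Suc N * k)"
        using zm z pos by (intro mult_mono) auto
      also have "\<dots> = 2 ^ (N + m + 1) * (x * real k)" by (simp add: power_add)
      finally have le: "z * real l \<le> 2 ^ (N + m + 1) * (x * real k)" .
      have "0 < 2 ^ N * k" using k by simp
      then have "l > 0" using l by (metis atLeastLessThan_iff less_le_trans)
      then show "1 / W_root \<omega> (2 ^ (N + m + 1) * (x * real k)) \<le> 1 / W_root \<omega> (z * real l)"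
        using z le by (intro divide_left_mono W_root_mono) auto
    qed
    finally have "(\<Sum>i<Suc N. 2 ^ i * real k / W_root \<omega> (2 ^ (i + m + 1) * (x * real k)))
      \<le> (\<Sum>l\<in>{k..<2 ^ N * k}. 1 / W_root \<omega> (z * real l))
        + (\<Sum>l\<in>{2 ^ N * k..<2 ^ Suc N * k}. 1 / W_root \<omega> (z * real l))"
      using Suc by simp
    also have "\<dots> = (\<Sum>l\<in>{k..<2 ^ Suc N * k}. 1 / W_root \<omega> (z * real l))"
      by (rule sum.atLeastLessThan_concat) auto
    finally show ?case .
  qed auto
  define F where "F = (\<lambda>t. t / W_root \<omega> t)"
  define D where "D = 2 ^ (m + 1) * A * C"
  have D: "D > 0" using z pos by (simp add: D_def)
  have F: "F t > 0" if "t > 0" for t using that by (simp add: F_def)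
  have Fsum: "(\<Sum>i<N. F (2 ^ (i + m + 1) * (x * real k))) \<le> D * F (x * real k)" if k: "k \<ge> 1" for k N
  proof -
    have "(\<Sum>i<N. F (2 ^ (i + m + 1) * (x * real k)))
        = 2 ^ (m + 1) * x * (\<Sum>i<N. 2 ^ i * real k / W_root \<omega> (2 ^ (i + m + 1) * (x * real k)))"
      by (simp add: F_def sum_distrib_left power_add mult_ac)
    also have "\<dots> \<le> 2 ^ (m + 1) * x * (\<Sum>l\<in>{k..<2 ^ N * k}. 1 / W_root \<omega> (z * real l))"
      using block[OF k] pos by (intro mult_left_mono) auto
    also have "(\<Sum>l\<in>{k..<2 ^ N * k}. 1 / W_root \<omega> (z * real l))
        = (\<Sum>l<2 ^ N * k - k. 1 / W_root \<omega> (z * real (l + k)))"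
      by (subst sum.atLeastLessThan_shift_0) (simp add: lessThan_atLeast0 add.commute)
    also have "2 ^ (m + 1) * x * \<dots> \<le> 2 ^ (m + 1) * x * (A * C * real k / W_root \<omega> (x * real k))"
      using part[OF k] pos by (intro mult_left_mono) auto
    also have "\<dots> = D * F (x * real k)" by (simp add: D_def F_def mult_ac)
    finally show ?thesis .
  qed
  \<comment> \<open>One summand of \<open>Fsum\<close> with \<open>k\<close> replaced by $2^j k$;
    the index shift forces the gap $m+1$.\<close>
  have Fle: "F (2 ^ p * (x * real k)) \<le> D * F (2 ^ j * (x * real k))"
    if k: "k \<ge> 1" and p: "p \<ge> j + m + 1" for k p j
  proof -
    obtain i where i: "p = i + m + 1 + j" using p by (metis le_Suc_ex add.commute add.assoc)
    have "F (2 ^ (i + m + 1) * (x * real (2 ^ j * k)))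
        \<le> (\<Sum>i<Suc i. F (2 ^ (i + m + 1) * (x * real (2 ^ j * k))))"
      by (rule member_le_sum) (use pos k in \<open>auto intro!: less_imp_le F\<close>)
    also have "\<dots> \<le> D * F (x * real (2 ^ j * k))" using k by (intro Fsum) auto
    also have "x * real (2 ^ j * k) = 2 ^ j * (x * real k)" by simp
    finally show ?thesis by (simp add: i power_add mult.assoc)
  qed
  \<comment> \<open>Makes \<open>F\<close> drop by a factor 8; the final rounding uses up a factor 2
    of it.\<close>
  obtain n :: nat where n: "8 * D\<^sup>2 < n" using reals_Archimedean2 by blast
  \<comment> \<open>Beyond each index $j+m+1$ with $j < n$ by more than $m+1$, so \<open>Fle\<close>
    applies to all of them.\<close>
  define p where "p = n + 2 * m + 2"
  have key: "8 * 2 ^ p * W_root \<omega> (x * real k) \<le> W_root \<omega> (2 ^ p * (x * real k))" if k: "k \<ge> 1" for k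
  proof -
    let ?w = "x * real k"
    have w: "?w > 0" using pos k by simp
    have "real n * F (2 ^ p * ?w) = (\<Sum>j<n. F (2 ^ p * ?w))" by simp
    also have "\<dots> \<le> (\<Sum>j<n. D * F (2 ^ (j + m + 1) * ?w))"
      by (intro sum_mono Fle k) (auto simp: p_def)
    also have "\<dots> = D * (\<Sum>j<n. F (2 ^ (j + m + 1) * ?w))" by (simp only: sum_distrib_left)
    also have "\<dots> \<le> D * (D * F ?w)" using Fsum[OF k] D by (intro mult_left_mono) auto
    also have "\<dots> = D\<^sup>2 * F ?w" by (simp add: power2_eq_square)
    also have "\<dots> \<le> (real n / 8) * F ?w" using n F[OF w] by (intro mult_right_mono) auto
    finally have "real n * F (2 ^ p * ?w) \<le> real n * (F ?w / 8)" by simp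
    moreover have "real n > 0" using n zero_le_power2[of D] by linarith
    ultimately have "F (2 ^ p * ?w) \<le> F ?w / 8" by simp
    then have "2 ^ p / W_root \<omega> (2 ^ p * ?w) * ?w \<le> 1 / (8 * W_root \<omega> ?w) * ?w"
      by (simp add: F_def)
    then have "2 ^ p / W_root \<omega> (2 ^ p * ?w) \<le> 1 / (8 * W_root \<omega> ?w)"
      using w by (simp only: mult_le_cancel_right_pos)
    then show ?thesis by (simp add: divide_simps mult_ac)
  qed
  have "(8 * 2 ^ p) * W_root \<omega> t \<le> W_root \<omega> (2 ^ Suc p * t)" if t: "t \<ge> x" for t
  proof -
    \<comment> \<open>Rounding gives $xk \<le> t \<le> 2xk$. The doubling raises the dilation to
      $2^{p+1}$, still below $8 * 2^p$.\<close>
    define k where "k = nat \<lfloor>t / x\<rfloor>"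
    have tx: "t / x \<ge> 1" using t pos by simp
    have k: "k \<ge> 1" using tx by (simp add: k_def le_nat_iff)
    have k1: "real k \<le> t / x" using tx by (simp add: k_def)
    have k2: "t / x \<le> real (2 * k)" using k tx unfolding k_def by linarith
    have le1: "t \<le> x * real (2 * k)" using k2 pos by (simp add: field_simps)
    have le2: "x * real k \<le> t" using k1 pos by (simp add: field_simps)
    have "(8 * 2 ^ p) * W_root \<omega> t \<le> (8 * 2 ^ p) * W_root \<omega> (x * real (2 * k))"
      using le1 t pos by (intro mult_left_mono W_root_mono) auto
    also have "\<dots> \<le> W_root \<omega> (2 ^ p * (x * real (2 * k)))" using k by (intro key) auto
    also have "\<dots> \<le> W_root \<omega> (2 ^ Suc p * t)" using le2 pos k by (intro W_root_mono) auto
    finally show ?thesis .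
  qed
  moreover have "(1::real) < 2 ^ Suc p" by (rule one_less_power) auto
  moreover have "(2::real) ^ Suc p < 8 * 2 ^ p" by simp
  ultimately show ?thesis unfolding superlinear_root_def using pos by blast
qed

section \<open>Construction of the strongly log-convex family\<close>

lemma phi_star_0: "phi_star \<omega> 0 = 0"
  using phi_star_nonneg[of 0] by (intro antisym phi_star_le) (auto simp: omega_nonneg)

lemma prod_vartheta_eq_W: "(\<Prod>i\<in>{0..k}. vartheta \<omega> x i) = W \<omega> x k"
proof (induction k)
  case 0
  show ?case by (simp add: W_def phi_star_0)
next
  case (Suc k)
  then show ?case by (simp add: vartheta_def W_def)
qed

text \<open>\<open>\<rho> x\<close> is the least increasing majorant of
  \<open>vartheta \<omega> x j / real j\<close>. Its monotonicity gives strong log-convexity, and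
  goodness says that the majorization costs a constant and a change of index.\<close>

lemma good_imp_strongly_log_convex_family:
  assumes good: "good_weight \<omega>"
  shows "\<exists>\<sigma> :: real \<Rightarrow> nat \<Rightarrow> real.
           (\<forall>x>0. weight_sequence (\<sigma> x) \<and> strongly_log_convex (\<sigma> x)) \<and>
           (\<forall>x>0. \<exists>y>0. lesssim (\<sigma> x) (vartheta \<omega> y)) \<and>
           (\<forall>x>0. \<exists>y>0. lesssim (vartheta \<omega> x) (\<sigma> y))"
proof -
  define \<rho> where "\<rho> = (\<lambda>x k. Max ((\<lambda>j. vartheta \<omega> x j / real j) ` {1..k}))"
  \<comment> \<open>At \<open>k = 0\<close> the maximum would run over the empty set.\<close>
  define \<sigma> where "\<sigma> = (\<lambda>x k. if k = 0 then 1 else real k * \<rho> x k)"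
  have \<rho>_ge: "vartheta \<omega> x j / real j \<le> \<rho> x k" if "1 \<le> j" "j \<le> k" for x j k
    unfolding \<rho>_def using that by (intro Max_ge) auto
  have \<rho>_mono: "\<rho> x (Suc k) \<le> \<rho> x (Suc (Suc k))" for x k
    unfolding \<rho>_def by (intro Max_mono) auto
  have \<rho>_pos: "0 < \<rho> x (Suc k)" for x k
    using \<rho>_ge[of 1 "Suc k" x] by (simp add: less_le_trans[OF vartheta_pos])
  have \<sigma>_ge: "vartheta \<omega> x k \<le> \<sigma> x k" for x k
    using \<rho>_ge[of k k x] by (cases "k = 0") (auto simp: \<sigma>_def field_simps)
  have slc: "strongly_log_convex (\<sigma> x)" for x
    using \<rho>_pos \<rho>_mono by (intro strongly_log_convex_if_ratio_mono[where \<rho>="\<rho> x"])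
      (auto simp: \<sigma>_def less_imp_le)
  have ws: "weight_sequence (\<sigma> x)" if x: "x > 0" for x
    unfolding weight_sequence_def
  proof (intro conjI)
    show "\<sigma> x 0 = 1" by (simp add: \<sigma>_def)
    show "incseq (\<sigma> x)"
    proof (rule incseq_SucI)
      fix k
      show "\<sigma> x k \<le> \<sigma> x (Suc k)"
      proof (cases k)
        case 0
        \<comment> \<open>The first step, from the value 1, is not covered by monotonicity of
          \<open>\<rho>\<close>.\<close>
        have "1 \<le> vartheta \<omega> x 1"
          using W_root_ge_1[OF x] W_root_le_vartheta[OF x, of 1] by simp
        also have "\<dots> \<le> \<sigma> x 1" by (rule \<sigma>_ge)
        finally show ?thesis by (simp add: 0 \<sigma>_def)
      next
        case (Suc j)
        then show ?thesis using \<rho>_mono[of x j] \<rho>_pos[of x j]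
          by (auto simp: \<sigma>_def less_imp_le intro!: mult_mono)
      qed
    qed
    \<comment> \<open>Since \<open>\<sigma>\<close> dominates the quotients, the roots of its
      products dominate $G(xk)$, which tends to infinity.\<close>
    have "filterlim (\<lambda>k. W_root \<omega> (real k * x)) at_top sequentially"
      using x by (intro filterlim_compose[OF W_root_at_top] filterlim_at_top_mult_tendsto_pos[OF tendsto_const]
        filterlim_real_sequentially) auto
    moreover have "eventually (\<lambda>k. W_root \<omega> (real k * x) \<le> Sprod (\<sigma> x) k powr (1 / real k)) sequentially"
      using eventually_ge_at_top[of 1]
    proof eventually_elim
      case (elim k)
      have "W \<omega> x k \<le> Sprod (\<sigma> x) k"
        unfolding Sprod_def prod_vartheta_eq_W[symmetric]
        by (intro prod_mono) (auto simp: \<sigma>_ge less_imp_le)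
      then have "W \<omega> x k powr (1 / real k) \<le> Sprod (\<sigma> x) k powr (1 / real k)"
        by (intro powr_mono2) (auto simp: W_def)
      then show ?case using elim by (simp add: W_powr_inverse_eq_W_root mult.commute)
    qed
    ultimately show "filterlim (\<lambda>k. Sprod (\<sigma> x) k powr (1 / real k)) at_top sequentially"
      by (rule filterlim_at_top_mono)
  qed
  have up: "\<exists>y>0. lesssim (\<sigma> x) (vartheta \<omega> y)" if x: "x > 0" for x
  proof -
    obtain y C where y: "y > 0" "C \<ge> 1"
      and le: "\<And>j k. 1 \<le> j \<Longrightarrow> j \<le> k \<Longrightarrow> vartheta \<omega> x j / real j \<le> C * vartheta \<omega> y k / real k"
      using good x unfolding good_weight_def by meson
    have "\<sigma> x k \<le> C * vartheta \<omega> y k" for k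
    proof (cases "k = 0")
      case False
      then have "\<rho> x k \<le> C * vartheta \<omega> y k / real k"
        unfolding \<rho>_def using le by (intro Max.boundedI) auto
      then show ?thesis using False by (simp add: \<sigma>_def field_simps)
    qed (use y in \<open>simp add: \<sigma>_def\<close>)
    then show ?thesis using y unfolding lesssim_def by (intro exI[of _ y] conjI exI[of _ C]) auto
  qed
  have "lesssim (vartheta \<omega> x) (\<sigma> x)" for x
    unfolding lesssim_def using \<sigma>_ge by (intro exI[of _ 1]) auto
  then show ?thesis using ws slc up by (intro exI[of _ \<sigma>]) blast
qed

end

theorem theorem5p15:
  fixes \<omega> :: "real \<Rightarrow> real"
  assumes wf: "weight_function \<omega>"
    and hyp: "\<forall>x>0. \<exists>y>0. \<exists>A>0. \<forall>k\<ge>1.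
               vartheta \<omega> x k \<le> A * W \<omega> y k powr (1 / real k)"
  shows "(strong_weight \<omega> \<longleftrightarrow>
            (\<forall>x>0. \<exists>y>0. \<exists>C>0. \<forall>k\<ge>1.
               summable (\<lambda>l. 1 / vartheta \<omega> y (l + k)) \<and>
               (\<Sum>l. 1 / vartheta \<omega> y (l + k)) \<le> C * real k / vartheta \<omega> x k))
       \<and> (strong_weight \<omega> \<longleftrightarrow>
            (\<exists>x>0. \<exists>y>0. \<exists>C>0. \<forall>k\<ge>1.
               summable (\<lambda>l. 1 / vartheta \<omega> y (l + k)) \<and>
               (\<Sum>l. 1 / vartheta \<omega> y (l + k)) \<le> C * real k / vartheta \<omega> x k))
       \<and> (strong_weight \<omega> \<longrightarrow>
            (\<exists>\<sigma> :: real \<Rightarrow> nat \<Rightarrow> real.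
               (\<forall>x>0. weight_sequence (\<sigma> x) \<and> strongly_log_convex (\<sigma> x)) \<and>
               (\<forall>x>0. \<exists>y>0. lesssim (\<sigma> x) (vartheta \<omega> y)) \<and>
               (\<forall>x>0. \<exists>y>0. lesssim (vartheta \<omega> x) (\<sigma> y)))
            \<and> good_weight \<omega>)"
proof -
  interpret weight_fun \<omega> by unfold_locales (fact wf)
  \<comment> \<open>Conditions (2) and (3) quantify this universally and existentially; strength
    gives it for every \<open>x\<close>, and a single \<open>x\<close> gives strength back.\<close>
  define tail where "tail = (\<lambda>x. \<exists>y>0. \<exists>C>0. \<forall>k\<ge>1.
               summable (\<lambda>l. 1 / vartheta \<omega> y (l + k)) \<and>
               (\<Sum>l. 1 / vartheta \<omega> y (l + k)) \<le> C * real k / vartheta \<omega> x k)"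
  have "tail x" if "strong_weight \<omega>" "x > 0" for x
    unfolding tail_def using that strong_iff_superlinear_root by (intro vartheta_tail_sum_le[OF hyp]) auto
  moreover have "strong_weight \<omega>" if "x > 0" "tail x" for x
  proof -
    obtain y C where "y > 0" "C > 0" "\<And>k. k \<ge> 1 \<Longrightarrow> summable (\<lambda>l. 1 / vartheta \<omega> y (l + k)) \<and>
               (\<Sum>l. 1 / vartheta \<omega> y (l + k)) \<le> C * real k / vartheta \<omega> x k"
      using \<open>tail x\<close> unfolding tail_def by blast
    from tail_sum_imp_superlinear_root[OF hyp \<open>x > 0\<close> this] show ?thesis
      by (simp add: strong_iff_superlinear_root)
  qed
  \<comment> \<open>A positive index exists, so the universal form implies the existential
    one.\<close>
  moreover have "(1::real) > 0" by simp
  ultimately have "strong_weight \<omega> \<longleftrightarrow> (\<forall>x>0. tail x)" "strong_weight \<omega> \<longleftrightarrow> (\<exists>x>0. tail x)"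
    by blast+
  moreover have "good_weight \<omega>" if "strong_weight \<omega>"
    using superlinear_root_imp_good[OF hyp] that by (simp add: strong_iff_superlinear_root)
  ultimately show ?thesis
    using good_imp_strongly_log_convex_family unfolding tail_def by (intro conjI impI) simp_all
qed

end
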